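(* Let $f:\{0,1\}^k\to\{0,1\}^n$ be a deterministic (not necessarily efficiently computable) function and let $U_k$ be uniform on $\{0,1\}^k$. Then for every $\epsilon>0$, $$\mathrm{H}^{\mathrm{HILL}}_{\tilde{O}(2^k\epsilon^2),\epsilon}(f(U_k))\le k+1.$$ More generally, for any random variable $X$ over $\{0,1\}^n$ whose support has size at most $2^k$, $$\mathrm{H}^{\mathrm{HILL}}_{\tilde{O}(2^k\epsilon^2),\epsilon}(X)\le k+1,$$ where $\tilde{O}(\cdot)$ hides a factor linear in $n$.
   Context: For random variables $X,Y$ over $\{0,1\}^n$: min-entropy $\mathrm{H}_\infty(X)=-\log_2\max_x\Pr[X=x]$. $X$ and $Y$ are $(s,\epsilon)$-indistinguishable, written $X\sim_{s,\epsilon}Y$, if every boolean circuit $D$ of size at most $s$ satisfies $|\Pr[D(X)=1]-\Pr[D(Y)=1]|\le\epsilon$. HILL pseudoentropy: $\mathrm{H}^{\mathrm{HILL}}_{s,\epsilon}(X)=\max_{Y:\,Y\sim_{s,\epsilon}X}\mathrm{H}_\infty(Y)$, the maximum over random variables $Y$ over $\{0,1\}^n$.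
   Formalization: The formal theorem assumes ε ≤ 1/2 (the claim fails for larger ε) and reads Õ(2^k ε²) as c·n·(2^k ε² + 1) with an absolute constant c; the added term c·n matters only when 2^k ε² < 1, where the literal bound can fail. *)

theory Defs
  imports "HOL-Probability.Probability"
begin

definition bits :: "nat \<Rightarrow> bool list set" where
  "bits n = {xs. length xs = n}"

text \<open>Boolean circuits over the basis AND/OR (fan-in 2) and NOT.
  Wires 0..n-1 are the inputs; the i-th gate (0-based) produces wire n+i and
  may only read wires with index < n+i (acyclicity).  A circuit is a gate list
  together with a designated output wire.  Its size is the number of gates.\<close>
datatype gate = AndG nat nat | OrG nat nat | NotG nat

fun gate_args :: "gate \<Rightarrow> nat set" where
  "gate_args (AndG i j) = {i, j}"
| "gate_args (OrG i j) = {i, j}"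
| "gate_args (NotG i) = {i}"

fun gate_val :: "bool list \<Rightarrow> gate \<Rightarrow> bool" where
  "gate_val v (AndG i j) = (v ! i \<and> v ! j)"
| "gate_val v (OrG i j) = (v ! i \<or> v ! j)"
| "gate_val v (NotG i) = (\<not> v ! i)"

type_synonym circuit = "gate list \<times> nat"

definition wf_circuit :: "nat \<Rightarrow> circuit \<Rightarrow> bool" where
  "wf_circuit n C \<longleftrightarrow>
     (\<forall>i < length (fst C). \<forall>a \<in> gate_args (fst C ! i). a < n + i)
     \<and> snd C < n + length (fst C)"

definition circuit_size :: "circuit \<Rightarrow> nat" where
  "circuit_size C = length (fst C)"

definition wire_values :: "bool list \<Rightarrow> gate list \<Rightarrow> bool list" where
  "wire_values x gs = foldl (\<lambda>v g. v @ [gate_val v g]) x gs"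

definition circuit_eval :: "circuit \<Rightarrow> bool list \<Rightarrow> bool" where
  "circuit_eval C x = wire_values x (fst C) ! snd C"

definition min_entropy :: "bool list pmf \<Rightarrow> real" where
  "min_entropy X = - log 2 (Sup (range (pmf X)))"

definition indist :: "nat \<Rightarrow> real \<Rightarrow> real \<Rightarrow> bool list pmf \<Rightarrow> bool list pmf \<Rightarrow> bool" where
  "indist n s eps X Y \<longleftrightarrow>
     (\<forall>D. wf_circuit n D \<and> real (circuit_size D) \<le> s \<longrightarrow>
        \<bar>measure_pmf.prob X {x. circuit_eval D x} - measure_pmf.prob Y {x. circuit_eval D x}\<bar> \<le> eps)"

definition HILL :: "nat \<Rightarrow> real \<Rightarrow> real \<Rightarrow> bool list pmf \<Rightarrow> real" where
  "HILL n s eps X = Sup {min_entropy Y | Y. set_pmf Y \<subseteq> bits n \<and> indist n s eps X Y}"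

end

theory Submission
  imports Defs "HOL-Library.List_Lexorder"
begin

text \<open>Let \<open>S\<close> be the support of \<open>X\<close>, let \<open>Y\<close> have min-entropy above \<open>k + 1\<close>, and let
  \<open>d = Pr[X = \<cdot>] - Pr[Y = \<cdot>]\<close>. Then \<open>d\<close> sums to 0 over the cube and to more than \<open>1/2\<close> over \<open>S\<close>.
  By Parseval, some parity or its complement has correlation at least the \<open>L\<^sup>2\<close> norm of any given
  function on the cube. Cut the cube into lexicographic intervals containing at most \<open>B\<close> points of
  \<open>S\<close> each and use the best signed parity on each of them: by Cauchy-Schwarz the resulting decision
  list has advantage at least \<open>d(S) / (2 sqrt B)\<close>, and it costs \<open>O(n)\<close> gates per interval. Taking
  \<open>B\<close> to be \<open>1 / (16 \<epsilon>\<^sup>2)\<close> rounded down gives advantage above \<open>\<epsilon>\<close> with \<open>O(n (2\<^sup>k \<epsilon>\<^sup>2 + 1))\<close> gates.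
  When \<open>\<epsilon> > 1/4\<close> this \<open>B\<close> is 0, but then testing membership in \<open>S\<close> is cheap enough.\<close>

section \<open>Composing circuits\<close>

text \<open>\<open>wf_circuit\<close> without its output wire, so that one gate list can carry
  several functions at once.\<close>

definition wf_gates :: "nat \<Rightarrow> gate list \<Rightarrow> bool" where
  "wf_gates n gs \<longleftrightarrow> (\<forall>i < length gs. \<forall>a \<in> gate_args (gs ! i). a < n + i)"

definition has_wire :: "nat \<Rightarrow> gate list \<Rightarrow> nat \<Rightarrow> (bool list \<Rightarrow> bool) \<Rightarrow> bool" where
  "has_wire n gs w f \<longleftrightarrow> w < n + length gs \<and> (\<forall>x\<in>bits n. wire_values x gs ! w = f x)"

definition computable :: "nat \<Rightarrow> nat \<Rightarrow> (bool list \<Rightarrow> bool) \<Rightarrow> bool" where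
  "computable n s f \<longleftrightarrow> (\<exists>gs w. wf_gates n gs \<and> length gs \<le> s \<and> has_wire n gs w f)"

fun map_gate :: "(nat \<Rightarrow> nat) \<Rightarrow> gate \<Rightarrow> gate" where
  "map_gate h (AndG i j) = AndG (h i) (h j)"
| "map_gate h (OrG i j) = OrG (h i) (h j)"
| "map_gate h (NotG i) = NotG (h i)"

text \<open>Relocation for a gate list placed behind \<open>l\<close> other gates: the inputs stay
  shared, while references to gates move along.\<close>

definition shift_wire :: "nat \<Rightarrow> nat \<Rightarrow> nat \<Rightarrow> nat" where
  "shift_wire n l i = (if i < n then i else i + l)"

lemma gate_args_map_gate: "gate_args (map_gate h g) = h ` gate_args g"
  by (cases g) auto

lemma gate_val_map_gate:
  assumes "\<And>a. a \<in> gate_args g \<Longrightarrow> v' ! h a = v ! a"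
  shows "gate_val v' (map_gate h g) = gate_val v g"
  using assms by (cases g) auto

section \<open>Evaluation and relocation of gate lists\<close>

lemma wire_values_Nil [simp]: "wire_values x [] = x"
  by (simp add: wire_values_def)

lemma wire_values_snoc [simp]:
  "wire_values x (gs @ [g]) = wire_values x gs @ [gate_val (wire_values x gs) g]"
  by (simp add: wire_values_def)

lemma length_wire_values [simp]: "length (wire_values x gs) = length x + length gs"
  by (induction gs rule: rev_induct) auto

lemma nth_wire_values_append:
  "w < length x + length gs \<Longrightarrow> wire_values x (gs @ hs) ! w = wire_values x gs ! w"
proof (induction hs rule: rev_induct)
  case (snoc h hs)
  then show ?case
    by (simp flip: append_assoc add: nth_append)
qed simp

lemma wf_gates_snoc:
  "wf_gates n (gs @ [g]) \<longleftrightarrow> wf_gates n gs \<and> (\<forall>a\<in>gate_args g. a < n + length gs)"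
  by (auto simp: wf_gates_def nth_append less_Suc_eq)

lemma wf_gates_append_shift:
  assumes "wf_gates n gs" "wf_gates n hs"
  shows "wf_gates n (gs @ map (map_gate (shift_wire n (length gs))) hs)"
  using assms(2)
proof (induction hs rule: rev_induct)
  case (snoc h hs)
  then show ?case
    by (auto simp: wf_gates_snoc gate_args_map_gate shift_wire_def simp flip: append_assoc)
qed (simp add: assms)

text \<open>Each relocated gate reads the same inputs and copies of the same earlier gates.
  Well-formedness puts its arguments before it, where the induction hypothesis applies.\<close>

lemma nth_wire_values_append_shift:
  assumes "wf_gates n hs" "length x = n" "w < n + length hs"
  shows "wire_values x (gs @ map (map_gate (shift_wire n (length gs))) hs)
            ! shift_wire n (length gs) w = wire_values x hs ! w"
  using assms
proof (induction hs arbitrary: w rule: rev_induct)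
  case Nil
  then show ?case
    using nth_wire_values_append[of w x "[]" gs] by (simp add: shift_wire_def)
next
  case (snoc h hs)
  let ?sh = "shift_wire n (length gs)"
  let ?v = "wire_values x (gs @ map (map_gate ?sh) hs)"
  have wf: "wf_gates n hs" "\<And>a. a \<in> gate_args h \<Longrightarrow> a < n + length hs"
    using snoc.prems(1) by (auto simp: wf_gates_snoc)
  have IH: "?v ! ?sh a = wire_values x hs ! a" if "a < n + length hs" for a
    using snoc.IH wf(1) snoc.prems(2) that by blast
  have val: "gate_val ?v (map_gate ?sh h) = gate_val (wire_values x hs) h"
    by (rule gate_val_map_gate) (use IH wf(2) in blast)
  have "wire_values x (gs @ map (map_gate ?sh) (hs @ [h])) = ?v @ [gate_val ?v (map_gate ?sh h)]"
    by (simp flip: append_assoc)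
  moreover have "?sh w < length ?v \<longleftrightarrow> w < n + length hs"
    using snoc.prems(2,3) by (auto simp: shift_wire_def)
  moreover have "?sh w = length ?v" if "\<not> w < n + length hs"
    using snoc.prems(2,3) that by (auto simp: shift_wire_def)
  ultimately show ?case
    using IH val snoc.prems(2,3) by (cases "w < n + length hs") (auto simp: nth_append)
qed

lemma has_wire_append:
  assumes "has_wire n gs w f"
  shows "has_wire n (gs @ hs) w f"
  using assms by (auto simp: has_wire_def nth_wire_values_append bits_def)

lemma has_wire_snoc:
  assumes "\<And>x. x \<in> bits n \<Longrightarrow> gate_val (wire_values x gs) g = f x"
  shows "has_wire n (gs @ [g]) (n + length gs) f"
  using assms by (auto simp: has_wire_def nth_append bits_def)

text \<open>Running the second circuit, relocated, behind the first makes both results available as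
  wires of one list, ready for a joining gate.\<close>

lemma computable_pairE:
  assumes "computable n s f" "computable n t g"
  obtains gs v w where "wf_gates n gs" "length gs \<le> s + t" "has_wire n gs v f" "has_wire n gs w g"
proof -
  obtain gs v where gs: "wf_gates n gs" "length gs \<le> s" "has_wire n gs v f"
    using assms(1) by (auto simp: computable_def)
  obtain hs w where hs: "wf_gates n hs" "length hs \<le> t" "has_wire n hs w g"
    using assms(2) by (auto simp: computable_def)
  let ?hs = "map (map_gate (shift_wire n (length gs))) hs"
  show ?thesis
  proof (rule that)
    show "wf_gates n (gs @ ?hs)"
      using gs(1) hs(1) by (rule wf_gates_append_shift)
    show "length (gs @ ?hs) \<le> s + t" using gs(2) hs(2) by simp
    show "has_wire n (gs @ ?hs) v f" using gs(3) by (rule has_wire_append)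
    show "has_wire n (gs @ ?hs) (shift_wire n (length gs) w) g"
      using hs(1,3) nth_wire_values_append_shift[OF hs(1)]
      by (auto simp: has_wire_def bits_def shift_wire_def)
  qed
qed

section \<open>Closure rules for circuit size\<close>

lemma computable_mono: "computable n s f \<Longrightarrow> s \<le> t \<Longrightarrow> computable n t f"
  by (meson computable_def le_trans)

lemma computable_cong:
  assumes "\<And>x. length x = n \<Longrightarrow> f x = g x"
  shows "computable n s f \<longleftrightarrow> computable n s g"
  using assms by (auto simp: computable_def has_wire_def bits_def)

lemma computable_nth: "i < n \<Longrightarrow> computable n 0 (\<lambda>x. x ! i)"
  by (auto simp: computable_def has_wire_def wf_gates_def)

lemma computable_not:
  assumes "computable n s f"
  shows "computable n (s + 1) (\<lambda>x. \<not> f x)"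
proof -
  obtain gs w where gs: "wf_gates n gs" "length gs \<le> s" "has_wire n gs w f"
    using assms by (auto simp: computable_def)
  have "has_wire n (gs @ [NotG w]) (n + length gs) (\<lambda>x. \<not> f x)"
    using gs(3) by (intro has_wire_snoc) (auto simp: has_wire_def)
  moreover have "wf_gates n (gs @ [NotG w])"
    using gs(1,3) by (auto simp: wf_gates_snoc has_wire_def)
  ultimately show ?thesis
    using gs(2) unfolding computable_def by (intro exI[of _ "gs @ [NotG w]"]) auto
qed

lemma computable_and:
  assumes "computable n s f" "computable n t g"
  shows "computable n (s + t + 1) (\<lambda>x. f x \<and> g x)"
proof -
  obtain gs v w where gs: "wf_gates n gs" "length gs \<le> s + t" "has_wire n gs v f" "has_wire n gs w g"
    using assms by (rule computable_pairE)
  have "has_wire n (gs @ [AndG v w]) (n + length gs) (\<lambda>x. f x \<and> g x)"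
    using gs(3,4) by (intro has_wire_snoc) (auto simp: has_wire_def)
  moreover have "wf_gates n (gs @ [AndG v w])"
    using gs(1,3,4) by (auto simp: wf_gates_snoc has_wire_def)
  ultimately show ?thesis
    using gs(2) unfolding computable_def by (intro exI[of _ "gs @ [AndG v w]"]) auto
qed

lemma computable_or:
  assumes "computable n s f" "computable n t g"
  shows "computable n (s + t + 1) (\<lambda>x. f x \<or> g x)"
proof -
  obtain gs v w where gs: "wf_gates n gs" "length gs \<le> s + t" "has_wire n gs v f" "has_wire n gs w g"
    using assms by (rule computable_pairE)
  have "has_wire n (gs @ [OrG v w]) (n + length gs) (\<lambda>x. f x \<or> g x)"
    using gs(3,4) by (intro has_wire_snoc) (auto simp: has_wire_def)
  moreover have "wf_gates n (gs @ [OrG v w])"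
    using gs(1,3,4) by (auto simp: wf_gates_snoc has_wire_def)
  ultimately show ?thesis
    using gs(2) unfolding computable_def by (intro exI[of _ "gs @ [OrG v w]"]) auto
qed

text \<open>Combining the closure rules above would duplicate both arguments; the gates for
  \<open>f\<close> and \<open>g\<close> are shared here so that parities have linear size.\<close>

lemma computable_xor:
  assumes "computable n s f" "computable n t g"
  shows "computable n (s + t + 4) (\<lambda>x. f x \<noteq> g x)"
proof -
  obtain gs v w where gs: "wf_gates n gs" "length gs \<le> s + t" "has_wire n gs v f" "has_wire n gs w g"
    using assms by (rule computable_pairE)
  define l where "l = n + length gs"
  \<comment> \<open>Exclusive or is the conjunction of OR and NAND; the four new gates occupy wires
    \<open>l\<close> to \<open>l + 3\<close>.\<close>
  define gs1 where "gs1 = gs @ [OrG v w]"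
  define gs2 where "gs2 = gs1 @ [AndG v w]"
  define gs3 where "gs3 = gs2 @ [NotG (l + 1)]"
  define gs4 where "gs4 = gs3 @ [AndG l (l + 2)]"
  note defs = gs1_def gs2_def gs3_def gs4_def
  have len: "n + length gs1 = l + 1" "n + length gs2 = l + 2" "n + length gs3 = l + 3"
    by (simp_all add: defs l_def)
  have lt: "v < l" "w < l" using gs(3,4) by (auto simp: has_wire_def l_def)
  have 1: "has_wire n gs1 l (\<lambda>x. f x \<or> g x)"
    using gs(3,4) unfolding gs1_def l_def by (intro has_wire_snoc) (auto simp: has_wire_def)
  have "has_wire n gs1 v f" "has_wire n gs1 w g"
    using gs(3,4) by (auto simp: gs1_def intro: has_wire_append)
  then have 2: "has_wire n gs2 (l + 1) (\<lambda>x. f x \<and> g x)"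
    unfolding gs2_def len(1)[symmetric] by (intro has_wire_snoc) (auto simp: has_wire_def)
  then have 3: "has_wire n gs3 (l + 2) (\<lambda>x. \<not> (f x \<and> g x))"
    unfolding gs3_def len(2)[symmetric] by (intro has_wire_snoc) (auto simp: has_wire_def)
  have "has_wire n gs3 l (\<lambda>x. f x \<or> g x)"
    using 1 by (auto simp: gs2_def gs3_def intro: has_wire_append)
  with 3 have 4: "has_wire n gs4 (l + 3) (\<lambda>x. f x \<noteq> g x)"
    unfolding gs4_def len(3)[symmetric] by (intro has_wire_snoc) (auto simp: has_wire_def)
  have "wf_gates n gs4"
    using gs(1) lt by (auto simp: defs wf_gates_snoc l_def simp del: append_assoc)
  moreover have "length gs4 \<le> s + t + 4" using gs(2) by (simp add: defs)
  ultimately show ?thesis using 4 unfolding computable_def by blast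
qed

text \<open>The basis has no constant gates, so a constant is made from an input bit and its
  negation; this takes \<open>n > 0\<close>.\<close>

lemma computable_const:
  assumes "n > 0"
  shows "computable n 2 (\<lambda>_. b)"
proof (cases b)
  case True
  have "computable n (0 + (0 + 1) + 1) (\<lambda>x. x ! 0 \<or> \<not> x ! 0)"
    using assms by (intro computable_or computable_not computable_nth)
  with True show ?thesis by (simp add: numeral_2_eq_2)
next
  case False
  have "computable n (0 + (0 + 1) + 1) (\<lambda>x. x ! 0 \<and> \<not> x ! 0)"
    using assms by (intro computable_and computable_not computable_nth)
  with False show ?thesis by (simp add: numeral_2_eq_2)
qed

text \<open>The condition is built once per branch, hence the \<open>2 * s\<close>.\<close>

lemma computable_if:
  assumes "computable n s c" "computable n t f" "computable n u g"
  shows "computable n (2 * s + t + u + 4) (\<lambda>x. if c x then f x else g x)"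
proof -
  have "computable n ((s + t + 1) + ((s + 1) + u + 1) + 1) (\<lambda>x. (c x \<and> f x) \<or> (\<not> c x \<and> g x))"
    by (intro computable_or computable_and computable_not assms)
  moreover have "(s + t + 1) + ((s + 1) + u + 1) + 1 = 2 * s + t + u + 4" by simp
  moreover have "(\<lambda>x. (c x \<and> f x) \<or> (\<not> c x \<and> g x)) = (\<lambda>x. if c x then f x else g x)" by auto
  ultimately show ?thesis by metis
qed

text \<open>\<open>F i x\<close> is meant to depend only on \<open>drop i x\<close>.\<close>

lemma computable_scan:
  assumes n: "n > 0" and j: "j \<le> n"
    and base: "\<And>x. length x = n \<Longrightarrow> F n x = b"
    and step: "\<And>i s. i < n \<Longrightarrow> computable n s (F (Suc i)) \<Longrightarrow> computable n (s + K) (F i)"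
  shows "computable n (2 + K * (n - j)) (F j)"
  using j
proof (induction rule: inc_induct)
  case base
  then show ?case
    using computable_const[OF n, of b] computable_cong[of n "F n" "\<lambda>_. b"] assms(3) by simp
next
  case (step i)
  have "computable n (2 + K * (n - Suc i) + K) (F i)"
    using step assms(4) by blast
  moreover have "2 + K * (n - Suc i) + K = 2 + K * (n - i)"
    using step.hyps by (simp flip: Suc_diff_Suc)
  ultimately show ?case by simp
qed

section \<open>Comparison, equality and membership tests\<close>

lemma computable_less:
  assumes n: "n > 0" and t: "length t = n"
  shows "computable n (2 + 2 * n) (\<lambda>x. x < t)"
proof -
  have "computable n (2 + 2 * (n - 0)) (\<lambda>x. drop 0 x < drop 0 t)"
  proof (rule computable_scan[where b = False])
    fix i s assume i: "i < n" and c: "computable n s (\<lambda>x. drop (Suc i) x < drop (Suc i) t)"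
    \<comment> \<open>As \<open>t\<close> is fixed, its bit merely selects how the input bit joins
      the verdict on the tails, where \<open>False < True\<close>. Either way a NOT and one binary
      gate suffice.\<close>
    have eq: "drop i x < drop i t \<longleftrightarrow>
        (if t ! i then \<not> x ! i \<or> drop (Suc i) x < drop (Suc i) t
         else \<not> x ! i \<and> drop (Suc i) x < drop (Suc i) t)" if "length x = n" for x
      using that t i by (auto simp flip: Cons_nth_drop_Suc)
    have "computable n ((0 + 1) + s + 1) (\<lambda>x. \<not> x ! i \<or> drop (Suc i) x < drop (Suc i) t)"
      "computable n ((0 + 1) + s + 1) (\<lambda>x. \<not> x ! i \<and> drop (Suc i) x < drop (Suc i) t)"
      by (intro computable_or computable_and computable_not computable_nth i c)+
    then show "computable n (s + 2) (\<lambda>x. drop i x < drop i t)"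
      by (subst computable_cong[OF eq]) (cases "t ! i"; simp)+
  qed (use n t in auto)
  then show ?thesis by simp
qed

lemma computable_eq:
  assumes n: "n > 0" and t: "length t = n"
  shows "computable n (2 + 2 * n) (\<lambda>x. x = t)"
proof -
  have "computable n (2 + 2 * (n - 0)) (\<lambda>x. drop 0 x = drop 0 t)"
  proof (rule computable_scan[where b = True])
    fix i s assume i: "i < n" and c: "computable n s (\<lambda>x. drop (Suc i) x = drop (Suc i) t)"
    have eq: "drop i x = drop i t \<longleftrightarrow>
        (if t ! i then x ! i \<and> drop (Suc i) x = drop (Suc i) t
         else \<not> x ! i \<and> drop (Suc i) x = drop (Suc i) t)" if "length x = n" for x
      using that t i by (auto simp flip: Cons_nth_drop_Suc)
    have "computable n (0 + s + 1) (\<lambda>x. x ! i \<and> drop (Suc i) x = drop (Suc i) t)"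
      "computable n ((0 + 1) + s + 1) (\<lambda>x. \<not> x ! i \<and> drop (Suc i) x = drop (Suc i) t)"
      by (intro computable_and computable_not computable_nth i c)+
    then show "computable n (s + 2) (\<lambda>x. drop i x = drop i t)"
      by (subst computable_cong[OF eq]) (cases "t ! i"; auto intro: computable_mono)+
  qed (use n t in auto)
  then show ?thesis by simp
qed

lemma computable_mem:
  assumes n: "n > 0" and "finite S" "S \<subseteq> bits n"
  shows "computable n (2 + (2 * n + 3) * card S) (\<lambda>x. x \<in> S)"
  using assms(2,3)
proof (induction rule: finite_induct)
  case empty
  then show ?case using computable_const[OF n, of False] by simp
next
  case (insert t S)
  have "computable n ((2 + 2 * n) + (2 + (2 * n + 3) * card S) + 1) (\<lambda>x. x = t \<or> x \<in> S)"
    using insert by (intro computable_or computable_eq n) (auto simp: bits_def)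
  moreover have "(2 + 2 * n) + (2 + (2 * n + 3) * card S) + 1 = 2 + (2 * n + 3) * card (insert t S)"
    using insert.hyps by (simp add: algebra_simps)
  ultimately show ?case by (simp only: insert_iff)
qed

section \<open>Parities\<close>

fun parity :: "bool list \<Rightarrow> bool list \<Rightarrow> bool" where
  "parity (a # as) (x # xs) = ((a \<and> x) \<noteq> parity as xs)"
| "parity _ _ = False"

text \<open>\<open>parity\<close> is the inner product modulo 2, so
  \<open>pm_sign (parity a x)\<close> is the negated Walsh character of \<open>a\<close> at
  \<open>x\<close>; the global sign vanishes in squares.\<close>

definition pm_sign :: "bool \<Rightarrow> real" where
  "pm_sign b = (if b then 1 else - 1)"

lemma computable_parity:
  assumes n: "n > 0" and a: "length a = n"
  shows "computable n (2 + 4 * n) (parity a)"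
proof -
  have "computable n (2 + 4 * (n - 0)) (\<lambda>x. parity (drop 0 a) (drop 0 x))"
  proof (rule computable_scan[where b = False])
    fix i s assume i: "i < n" and c: "computable n s (\<lambda>x. parity (drop (Suc i) a) (drop (Suc i) x))"
    have eq: "parity (drop i a) (drop i x) \<longleftrightarrow>
        (if a ! i then x ! i \<noteq> parity (drop (Suc i) a) (drop (Suc i) x)
         else parity (drop (Suc i) a) (drop (Suc i) x))" if "length x = n" for x
      using that a i by (auto simp flip: Cons_nth_drop_Suc)
    have "computable n (0 + s + 4) (\<lambda>x. x ! i \<noteq> parity (drop (Suc i) a) (drop (Suc i) x))"
      by (intro computable_xor computable_nth i c)
    then show "computable n (s + 4) (\<lambda>x. parity (drop i a) (drop i x))"
      using c by (subst computable_cong[OF eq]) (cases "a ! i"; auto intro: computable_mono)+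
  qed (use n a in auto)
  then show ?thesis by simp
qed

section \<open>Parseval on the cube and correlation with parities\<close>

lemma bits_0 [simp]: "bits 0 = {[]}"
  by (auto simp: bits_def)

lemma bits_eq_lists: "bits n = {xs. set xs \<subseteq> UNIV \<and> length xs = n}"
  by (simp add: bits_def)

lemma finite_bits [simp]: "finite (bits n)"
  unfolding bits_eq_lists by (rule finite_lists_length_eq) simp

lemma card_bits [simp]: "card (bits n) = 2 ^ n"
  unfolding bits_eq_lists by (subst card_lists_length_eq) simp_all

lemma sum_bits_Suc:
  fixes g :: "bool list \<Rightarrow> real"
  shows "sum g (bits (Suc n)) = (\<Sum>x\<in>bits n. g (False # x) + g (True # x))"
proof -
  have "bits (Suc n) = (#) False ` bits n \<union> (#) True ` bits n"
    by (force simp: bits_def length_Suc_conv)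
  then have "sum g (bits (Suc n)) = sum g ((#) False ` bits n) + sum g ((#) True ` bits n)"
    by (simp, subst sum.union_disjoint) auto
  then show ?thesis by (simp add: sum.reindex sum.distrib)
qed

text \<open>One step of the fast Walsh transform: splitting off the first coordinate, the
  coefficients of \<open>g\<close> are those of the sum \<open>u\<close> and of the difference
  \<open>v\<close> of its two halves.\<close>

lemma parseval_parity:
  "(\<Sum>a\<in>bits n. (\<Sum>x\<in>bits n. g x * pm_sign (parity a x))\<^sup>2) = 2 ^ n * (\<Sum>x\<in>bits n. (g x)\<^sup>2)"
proof (induction n arbitrary: g)
  case 0
  then show ?case by (simp add: pm_sign_def)
next
  case (Suc n)
  let ?F = "\<lambda>g a. \<Sum>x\<in>bits n. g x * pm_sign (parity a x)"
  define u where "u = (\<lambda>x. g (False # x) + g (True # x))"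
  define v where "v = (\<lambda>x. g (False # x) - g (True # x))"
  have "(\<Sum>x\<in>bits (Suc n). g x * pm_sign (parity (False # a) x)) = ?F u a"
    "(\<Sum>x\<in>bits (Suc n). g x * pm_sign (parity (True # a) x)) = ?F v a" for a
    by (auto simp: sum_bits_Suc u_def v_def pm_sign_def algebra_simps intro!: sum.cong)
  then have "(\<Sum>a\<in>bits (Suc n). (\<Sum>x\<in>bits (Suc n). g x * pm_sign (parity a x))\<^sup>2)
      = (\<Sum>a\<in>bits n. (?F u a)\<^sup>2 + (?F v a)\<^sup>2)"
    by (simp add: sum_bits_Suc[of _ n])
  also have "\<dots> = 2 ^ n * (\<Sum>x\<in>bits n. (u x)\<^sup>2 + (v x)\<^sup>2)"
    by (simp only: sum.distrib Suc.IH distrib_left)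
  \<comment> \<open>The parallelogram law at each point supplies the new factor 2.\<close>
  also have "\<dots> = 2 ^ n * (\<Sum>x\<in>bits n. 2 * ((g (False # x))\<^sup>2 + (g (True # x))\<^sup>2))"
    by (auto simp: u_def v_def power2_eq_square algebra_simps intro!: sum.cong)
  finally show ?case by (simp add: sum_bits_Suc[of _ n] flip: sum_distrib_left del: distrib_left_numeral)
qed

text \<open>Averaging: the \<open>2 ^ n\<close> squared coefficients have mean equal to the
  right-hand side of Parseval divided by \<open>2 ^ n\<close>.\<close>

lemma exists_correlated_parity:
  "\<exists>a\<in>bits n. (\<Sum>x\<in>bits n. (g x)\<^sup>2) \<le> (\<Sum>x\<in>bits n. g x * pm_sign (parity a x))\<^sup>2"
proof (rule ccontr)
  assume "\<not> ?thesis"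
  then have "(\<Sum>a\<in>bits n. (\<Sum>x\<in>bits n. g x * pm_sign (parity a x))\<^sup>2)
      < (\<Sum>a\<in>bits n. \<Sum>x\<in>bits n. (g x)\<^sup>2)"
    using card_bits[of n] by (intro sum_strict_mono) (auto simp del: card_bits)
  then show False by (simp add: parseval_parity)
qed

text \<open>Cauchy-Schwarz on \<open>S\<close> bounds the sum by \<open>sqrt B\<close> times the
  norm on \<open>S\<close>, and values of \<open>g\<close> outside \<open>S\<close> can only
  increase the norm. Hence the circuit never has to recognise \<open>S\<close>.\<close>

lemma exists_correlated_circuit:
  fixes g :: "bool list \<Rightarrow> real"
  assumes n: "n > 0" and S: "S \<subseteq> bits n" "card S \<le> B" and B: "B > 0"
  obtains D where "computable n (7 * n) D"
    "sum g S / sqrt B \<le> (\<Sum>x\<in>bits n. g x * pm_sign (D x))"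
proof -
  obtain a where a: "a \<in> bits n"
    and le: "(\<Sum>x\<in>bits n. (g x)\<^sup>2) \<le> (\<Sum>x\<in>bits n. g x * pm_sign (parity a x))\<^sup>2"
    using exists_correlated_parity by blast
  let ?T = "\<Sum>x\<in>bits n. g x * pm_sign (parity a x)"
  have "(sum g S)\<^sup>2 \<le> card S * (\<Sum>x\<in>S. (g x)\<^sup>2)"
    using Cauchy_Schwarz_ineq_sum[of "\<lambda>_. 1" g S] by simp
  also have "\<dots> \<le> real B * (\<Sum>x\<in>bits n. (g x)\<^sup>2)"
    using S by (intro mult_mono sum_mono2 sum_nonneg) auto
  also have "\<dots> \<le> real B * ?T\<^sup>2"
    using le by (intro mult_left_mono) auto
  finally have "\<bar>sum g S\<bar> \<le> sqrt (real B * ?T\<^sup>2)"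
    by (metis real_sqrt_abs real_sqrt_le_iff)
  then have "sum g S \<le> sqrt B * \<bar>?T\<bar>"
    by (simp add: real_sqrt_mult)
  then have T: "sum g S / sqrt B \<le> \<bar>?T\<bar>"
    using B by (simp add: divide_le_eq mult.commute)
  have c: "computable n (2 + 4 * n) (parity a)"
    using computable_parity[OF n] a by (simp add: bits_def)
  show ?thesis
  \<comment> \<open>Only the square of the correlation is controlled. If it is negative, the
    complement is taken; its \<open>4 * n + 3\<close> gates are at most
    \<open>7 * n\<close>.\<close>
  proof (cases "?T \<ge> 0")
    case True
    then show ?thesis
      using T n by (intro that[of "parity a"] computable_mono[OF c]) auto
  next
    case False
    have "(\<Sum>x\<in>bits n. g x * pm_sign (\<not> parity a x)) = - ?T"
      by (auto simp: pm_sign_def simp flip: sum_negf intro!: sum.cong)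
    then show ?thesis
      using T n False
      by (intro that[of "\<lambda>x. \<not> parity a x"] computable_mono[OF computable_not[OF c]]) auto
  qed
qed

section \<open>Decision lists of parities\<close>

text \<open>The entry at index \<open>m\<close>, counted from 0, of the sorted list; it provides the
  cut points between intervals.\<close>

lemma exists_rank:
  fixes S :: "'a::linorder set"
  assumes "finite S" "m < card S"
  obtains t where "t \<in> S" "card {x \<in> S. x < t} = m"
proof -
  let ?xs = "sorted_list_of_set S"
  have len: "length ?xs = card S" by simp
  have sorted: "sorted_wrt (<) ?xs" by simp
  have less: "?xs ! i < ?xs ! m \<longleftrightarrow> i < m" if "i < card S" for i
    using sorted_wrt_nth_less[OF sorted, of i m] sorted_wrt_nth_less[OF sorted, of m i]
      that assms(2) len by (metis linorder_neqE_nat order_less_asym order_less_irrefl)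
  have "{x \<in> S. x < ?xs ! m} = (!) ?xs ` {i. i < card S \<and> ?xs ! i < ?xs ! m}"
  proof -
    have "(!) ?xs ` {..<card S} = S"
      using assms(1) len nth_image[of "card S" ?xs] by (simp add: lessThan_atLeast0)
    then have "x \<in> S \<longleftrightarrow> (\<exists>i<card S. x = ?xs ! i)" for x
      by (metis (no_types, lifting) imageE image_eqI lessThan_iff)
    then show ?thesis by (simp add: set_eq_iff image_iff) blast
  qed
  also have "{i. i < card S \<and> ?xs ! i < ?xs ! m} = {0..<m}"
    using less assms(2) by auto
  also have "(!) ?xs ` {0..<m} = set (take m ?xs)"
    using assms(2) len by (intro nth_image) simp
  finally have "{x \<in> S. x < ?xs ! m} = set (take m ?xs)" .
  moreover have "card (set (take m ?xs)) = m"
    using assms by (subst distinct_card) auto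
  moreover have "?xs ! m \<in> S"
    using assms len by (metis nth_mem set_sorted_list_of_set)
  ultimately show ?thesis using that by metis
qed

text \<open>Induction on the number of intervals: a threshold test splits off the lowest
  \<open>B\<close> points of \<open>S\<close> for one signed parity, and the rest is left to the
  induction hypothesis.\<close>

lemma exists_correlated_decision_list:
  fixes g :: "bool list \<Rightarrow> real"
  assumes n: "n > 0" and S: "S \<subseteq> bits n" "card S \<le> m * B" and B: "B > 0"
  shows "\<exists>D. computable n (19 * n * (m + 1)) D
    \<and> sum g S / sqrt B \<le> (\<Sum>x\<in>bits n. g x * pm_sign (D x))"
  using S
proof (induction m arbitrary: g S)
  case 0
  \<comment> \<open>Here \<open>S\<close> is empty, so only a nonnegative correlation is asked
    for.\<close>
  obtain D where "computable n (7 * n) D" "sum g S / sqrt B \<le> (\<Sum>x\<in>bits n. g x * pm_sign (D x))"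
    using exists_correlated_circuit[OF n 0(1) _ B, of g] 0 by auto
  moreover from this have "computable n (19 * n * (0 + 1)) D"
    by (elim computable_mono) simp
  ultimately show ?case by blast
next
  case (Suc m)
  have fin: "finite S" using finite_subset[OF Suc.prems(1)] by simp
  show ?case
  \<comment> \<open>A point of \<open>S\<close> with exactly \<open>B\<close> smaller ones exists
    only above this bound; up to it, one signed parity serves all of \<open>S\<close>.\<close>
  proof (cases "card S \<le> B")
    case True
    obtain D where "computable n (7 * n) D" "sum g S / sqrt B \<le> (\<Sum>x\<in>bits n. g x * pm_sign (D x))"
      using exists_correlated_circuit[OF n Suc.prems(1) True B, of g] by auto
    moreover from this have "computable n (19 * n * (Suc m + 1)) D"
      by (elim computable_mono) simp
    ultimately show ?thesis by blast
  next
    case False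
    then obtain t where t: "t \<in> S" "card {x \<in> S. x < t} = B"
      using exists_rank[OF fin, of B] by auto
    define L where "L = {x \<in> S. x < t}"
    define R where "R = {x \<in> S. \<not> x < t}"
    have S_eq: "S = L \<union> R" "L \<inter> R = {}" "finite L" "finite R"
      using fin by (auto simp: L_def R_def)
    have "card S = card L + card R"
      using S_eq by (metis card_Un_disjoint)
    then have R: "R \<subseteq> bits n" "card R \<le> m * B"
      using t(2) Suc.prems by (auto simp: L_def R_def)
    have L: "L \<subseteq> bits n" "card L \<le> B"
      using t(2) Suc.prems by (auto simp: L_def)
    \<comment> \<open>Zeroing \<open>g\<close> beyond the cut keeps each branch from being credited
      for inputs on which the other one answers, so the two correlations add up.\<close>
    define gl where "gl = (\<lambda>x. if x < t then g x else 0)"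
    define gr where "gr = (\<lambda>x. if x < t then 0 else g x)"
    obtain P where P: "computable n (7 * n) P"
      "sum gl L / sqrt B \<le> (\<Sum>x\<in>bits n. gl x * pm_sign (P x))"
      using exists_correlated_circuit[OF n L B, of gl] by auto
    obtain D where D: "computable n (19 * n * (m + 1)) D"
      "sum gr R / sqrt B \<le> (\<Sum>x\<in>bits n. gr x * pm_sign (D x))"
      using Suc.IH[OF R, of gr] by auto
    let ?D = "\<lambda>x. if x < t then P x else D x"
    \<comment> \<open>Apart from the recursive part this is \<open>11 * n + 8\<close>, at most
      \<open>19 * n\<close> as \<open>n > 0\<close>; hence the constant 19.\<close>
    have "computable n (2 * (2 + 2 * n) + 7 * n + 19 * n * (m + 1) + 4) ?D"
      using t(1) Suc.prems(1) by (intro computable_if computable_less n P D) (auto simp: bits_def)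
    then have "computable n (19 * n * (Suc m + 1)) ?D"
      by (rule computable_mono) (use n in auto)
    moreover have "sum g S / sqrt B \<le> (\<Sum>x\<in>bits n. g x * pm_sign (?D x))"
    proof -
      have "sum g S = sum g L + sum g R"
        using S_eq by (simp add: sum.union_disjoint)
      moreover have "sum g L = sum gl L" "sum g R = sum gr R"
        by (auto simp: gl_def gr_def L_def R_def intro!: sum.cong)
      ultimately have "sum g S = sum gl L + sum gr R" by simp
      then have "sum g S / sqrt B \<le>
          (\<Sum>x\<in>bits n. gl x * pm_sign (P x)) + (\<Sum>x\<in>bits n. gr x * pm_sign (D x))"
        using P(2) D(2) by (simp add: add_divide_distrib)
      also have "\<dots> = (\<Sum>x\<in>bits n. g x * pm_sign (?D x))"
        unfolding sum.distrib[symmetric] by (intro sum.cong) (auto simp: gl_def gr_def)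
      finally show ?thesis .
    qed
    ultimately show ?thesis by blast
  qed
qed

section \<open>Distinguishers\<close>

lemma prob_eq_sum_bits:
  assumes "set_pmf X \<subseteq> bits n"
  shows "measure_pmf.prob X A = (\<Sum>x\<in>bits n. if x \<in> A then pmf X x else 0)"
proof -
  have "measure_pmf.prob X A = measure_pmf.prob X (A \<inter> bits n)"
    using assms by (intro measure_pmf.finite_measure_eq_AE) (auto simp: AE_measure_pmf_iff)
  also have "\<dots> = (\<Sum>x\<in>A \<inter> bits n. pmf X x)"
    by (simp add: measure_measure_pmf_finite)
  also have "\<dots> = (\<Sum>x\<in>bits n. if x \<in> A then pmf X x else 0)"
    by (simp add: sum.inter_restrict[symmetric] Int_commute)
  finally show ?thesis .
qed

text \<open>Turns indistinguishability into a bound on finite sums. The supports confine both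
  probabilities to the cube, where \<open>circuit_eval\<close> is known to agree with
  \<open>D\<close>.\<close>

lemma indist_computable:
  assumes "indist n s eps X Y" "computable n l D" "real l \<le> s"
    and X: "set_pmf X \<subseteq> bits n" and Y: "set_pmf Y \<subseteq> bits n"
  shows "\<bar>\<Sum>x\<in>bits n. if D x then pmf X x - pmf Y x else 0\<bar> \<le> eps"
proof -
  obtain gs w where gs: "wf_gates n gs" "length gs \<le> l" "has_wire n gs w D"
    using assms(2) by (auto simp: computable_def)
  have "wf_circuit n (gs, w)" "real (circuit_size (gs, w)) \<le> s"
    using gs assms(3) by (auto simp: wf_circuit_def wf_gates_def has_wire_def circuit_size_def)
  then have "\<bar>measure_pmf.prob X {x. circuit_eval (gs, w) x}
      - measure_pmf.prob Y {x. circuit_eval (gs, w) x}\<bar> \<le> eps"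
    using assms(1) by (simp add: indist_def)
  moreover have "measure_pmf.prob X {x. circuit_eval (gs, w) x}
      - measure_pmf.prob Y {x. circuit_eval (gs, w) x}
      = (\<Sum>x\<in>bits n. if D x then pmf X x - pmf Y x else 0)"
    unfolding prob_eq_sum_bits[OF X] prob_eq_sum_bits[OF Y] sum_subtractf[symmetric]
    using gs(3) by (intro sum.cong) (auto simp: circuit_eval_def has_wire_def)
  ultimately show ?thesis by simp
qed

section \<open>The entropy bound\<close>

lemma pmf_less_of_min_entropy:
  assumes "real k + 1 < min_entropy Y"
  shows "pmf Y y < 1 / 2 ^ (k + 1)"
proof -
  let ?M = "Sup (range (pmf Y))"
  have bdd: "bdd_above (range (pmf Y))"
    by (intro bdd_aboveI2[of _ _ 1]) (simp add: pmf_le_1)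
  \<comment> \<open>A support point makes the supremum positive, so that the logarithm can be
    inverted.\<close>
  obtain z where "z \<in> set_pmf Y" using set_pmf_not_empty[of Y] by blast
  then have "0 < pmf Y z" by (simp add: pmf_positive)
  also have "\<dots> \<le> ?M" using bdd by (simp add: cSUP_upper)
  finally have "0 < ?M" .
  moreover have "log 2 ?M < - real (k + 1)"
    using assms by (simp add: min_entropy_def)
  ultimately have "?M < 2 powr (- real (k + 1))"
    by (simp add: log_less_iff)
  also have "\<dots> = 1 / 2 ^ (k + 1)"
    by (simp add: powr_minus_divide powr_realpow del: of_nat_Suc of_nat_add)
  finally show ?thesis
    using cSUP_upper[OF UNIV_I bdd, of y] by simp
qed

lemma min_entropy_le_of_indist:
  assumes eps: "0 < eps" "eps \<le> 1/2"
    and X: "set_pmf X \<subseteq> bits n" "card (set_pmf X) \<le> 2 ^ k"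
    and Y: "set_pmf Y \<subseteq> bits n"
    and ind: "indist n (1000 * real n * (2 ^ k * eps\<^sup>2 + 1)) eps X Y"
  shows "min_entropy Y \<le> real k + 1"
proof (rule ccontr)
  assume "\<not> ?thesis"
  then have small: "pmf Y y < 1 / 2 ^ (k + 1)" for y
    using pmf_less_of_min_entropy[of k Y y] by simp
  \<comment> \<open>On the one-point cube \<open>Y\<close> has mass 1 at \<open>[]\<close>,
    contradicting \<open>small\<close>.\<close>
  have n: "n > 0"
  proof (rule ccontr)
    assume "\<not> n > 0"
    then have "set_pmf Y = {[]}"
      using Y set_pmf_not_empty[of Y] by auto
    then have "pmf Y [] = 1"
      by (metis indicator_simps(1) pmf_return set_pmf_subset_singleton singletonI subset_refl)
    moreover have "1 / 2 ^ (k + 1) \<le> (1::real)"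
      by (simp only: divide_le_eq_1 one_le_power one_le_numeral) simp
    ultimately show False using small[of "[]"] by linarith
  qed
  define S where "S = set_pmf X"
  have S: "S \<subseteq> bits n" "card S \<le> 2 ^ k" "finite S" "S \<noteq> {}"
    using X finite_subset[OF X(1)] by (auto simp: S_def set_pmf_not_empty)
  define d where "d = (\<lambda>x. pmf X x - pmf Y x)"
  \<comment> \<open>The extra bit of entropy is spent here: at most \<open>2 ^ k\<close> points,
    each of mass below \<open>1 / 2 ^ (k + 1)\<close>, leave \<open>Y\<close> less than half its
    mass on \<open>S\<close>.\<close>
  have "sum (pmf Y) S < card S * (1 / 2 ^ (k + 1))"
    using S small sum_strict_mono[OF S(3,4), of "pmf Y" "\<lambda>_. 1 / 2 ^ (k + 1)"] by simp
  also have "\<dots> \<le> 2 ^ k * (1 / 2 ^ (k + 1))"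
    using S(2) by (intro mult_right_mono) (use of_nat_mono[OF S(2), where 'a = real] in simp_all)
  finally have "sum (pmf Y) S < 1 / 2" by simp
  moreover have "sum (pmf X) S = 1"
    using S(3) by (intro sum_pmf_eq_1) (auto simp: S_def)
  ultimately have dS: "sum d S > 1 / 2" by (simp add: d_def sum_subtractf)
  have dist: "(\<Sum>x\<in>bits n. if D x then d x else 0) \<le> eps"
    if "computable n l D" "real l \<le> 1000 * real n * (2 ^ k * eps\<^sup>2 + 1)" for l D
    using abs_le_D1[OF indist_computable[OF ind that X(1) Y]] unfolding d_def .
  show False
  proof (cases "eps \<le> 1/4")
    case False
    have "1 / 16 \<le> eps\<^sup>2"
      using False power_mono[of "1/4" eps 2] by (simp add: power2_eq_square)
    have "2 + (2 * n + 3) * card S \<le> 7 * n * 2 ^ k"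
    proof -
      have "2 + (2 * n + 3) * card S \<le> 2 * 2 ^ k + (2 * n + 3) * 2 ^ k"
        using S(2) by (intro add_mono mult_left_mono) auto
      also have "\<dots> = (2 * n + 5) * 2 ^ k" by (simp add: algebra_simps)
      also have "\<dots> \<le> 7 * n * 2 ^ k" using n by (intro mult_right_mono) auto
      finally show ?thesis .
    qed
    then have "computable n (7 * n * 2 ^ k) (\<lambda>x. x \<in> S)"
      using computable_mem[OF n S(3,1)] computable_mono by blast
    moreover have "real (7 * n * 2 ^ k) \<le> 1000 * real n * (2 ^ k * eps\<^sup>2 + 1)"
    proof -
      \<comment> \<open>\<open>112 = 7 * 16\<close> prepares for
        \<open>1 / 16 \<le> eps\<^sup>2\<close>.\<close>
      have "real (7 * n * 2 ^ k) = 112 * real n * (2 ^ k * (1 / 16))" by simp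
      also have "\<dots> \<le> 1000 * real n * (2 ^ k * eps\<^sup>2 + 1)"
        using \<open>1 / 16 \<le> eps\<^sup>2\<close> by (intro mult_mono add_increasing2) auto
      finally show ?thesis .
    qed
    ultimately have "(\<Sum>x\<in>bits n. if x \<in> S then d x else 0) \<le> eps" by (rule dist)
    moreover have "(\<Sum>x\<in>bits n. if x \<in> S then d x else 0) = sum d S"
      using S(1) by (simp add: sum.inter_restrict[symmetric] Int_absorb1)
    ultimately show False using dS eps by simp
  next
    case True
    \<comment> \<open>Chosen so that \<open>2 * eps * sqrt r = 1 / 2\<close>, which meets the lower
      bound on \<open>sum d S\<close>. The case \<open>eps \<le> 1/4\<close> is exactly
      \<open>r \<ge> 1\<close>.\<close>
    define r where "r = 1 / (16 * eps\<^sup>2)"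
    define B where "B = nat \<lfloor>r\<rfloor>"
    have "eps\<^sup>2 \<le> 1 / 16"
      using True eps power_mono[of eps "1/4" 2] by (simp add: power2_eq_square)
    then have r: "r \<ge> 1" using eps by (simp add: r_def)
    have "1 \<le> \<lfloor>r\<rfloor>" using r by simp
    then have "real B = \<lfloor>r\<rfloor>" "B > 0" by (simp_all add: B_def)
    \<comment> \<open>As \<open>r \<ge> 1\<close>, rounding down loses at most a factor 2.\<close>
    then have B: "real B \<le> r" "r \<le> 2 * real B" "B > 0"
      using \<open>1 \<le> \<lfloor>r\<rfloor>\<close> by linarith+
    define m where "m = nat \<lceil>2 ^ k / real B\<rceil>"
    have "2 ^ k / real B \<le> real m" by (simp add: m_def real_nat_ceiling_ge)
    then have "real (2 ^ k) \<le> real (m * B)"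
      using B(3) by (simp add: divide_le_eq)
    then have "card S \<le> m * B" using S(2) of_nat_le_iff le_trans by blast
    then obtain D where D: "computable n (19 * n * (m + 1)) D"
      "sum d S / sqrt B \<le> (\<Sum>x\<in>bits n. d x * pm_sign (D x))"
      using exists_correlated_decision_list[OF n S(1) _ B(3)] by blast
    have "real m \<le> 2 ^ k / real B + 1"
      unfolding m_def by (simp add: of_nat_ceiling)
    also have "2 ^ k / real B \<le> 2 ^ k / (r / 2)"
      using B r by (intro divide_left_mono) auto
    also have "\<dots> = 32 * (2 ^ k * eps\<^sup>2)" by (simp add: r_def)
    finally have m: "real m \<le> 32 * (2 ^ k * eps\<^sup>2) + 1" by simp
    \<comment> \<open>With \<open>q = 2 ^ k * eps\<^sup>2\<close>, \<open>m + 1\<close> is at most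
      \<open>32 * q + 2\<close>, hence at most \<open>32 * (q + 1)\<close>; the \<open>+ 1\<close>
      in the size bound absorbs rounding and the last leaf.\<close>
    have "real (19 * n * (m + 1)) = 19 * real n * (real m + 1)"
      by (simp add: algebra_simps)
    also have "\<dots> \<le> 19 * real n * (32 * (2 ^ k * eps\<^sup>2 + 1))"
      using m by (intro mult_left_mono) auto
    also have "\<dots> = 608 * real n * (2 ^ k * eps\<^sup>2 + 1)" by (simp add: algebra_simps)
    also have "\<dots> \<le> 1000 * real n * (2 ^ k * eps\<^sup>2 + 1)"
      by (intro mult_right_mono) auto
    finally have le: "(\<Sum>x\<in>bits n. if D x then d x else 0) \<le> eps"
      by (intro dist[OF D(1)])
    \<comment> \<open>\<open>pm_sign\<close> is twice the indicator minus 1 and \<open>d\<close> has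
      total 0, so the signed correlation is twice the distinguishing gap.\<close>
    have "sum (pmf X) (bits n) = 1" "sum (pmf Y) (bits n) = 1"
      using X Y by (auto intro!: sum_pmf_eq_1)
    then have "sum d (bits n) = 0" by (simp add: d_def sum_subtractf)
    moreover have "(\<Sum>x\<in>bits n. d x * pm_sign (D x)) + sum d (bits n)
        = 2 * (\<Sum>x\<in>bits n. if D x then d x else 0)"
      unfolding sum_distrib_left sum.distrib[symmetric] by (intro sum.cong) (auto simp: pm_sign_def)
    ultimately have "sum d S / sqrt B \<le> 2 * eps" using D(2) le by simp
    then have "sum d S \<le> 2 * eps * sqrt B" using B(3) by (simp add: divide_le_eq)
    also have "\<dots> \<le> 2 * eps * sqrt r" using B eps by simp
    also have "sqrt r = 1 / (4 * eps)"
      using eps by (simp add: r_def real_sqrt_divide real_sqrt_mult)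
    finally show False using dS eps by simp
  qed
qed

lemma HILL_le:
  assumes "0 < eps" "eps \<le> 1/2"
    and X: "set_pmf X \<subseteq> bits n" "card (set_pmf X) \<le> 2 ^ k"
  shows "HILL n (1000 * real n * (2 ^ k * eps\<^sup>2 + 1)) eps X \<le> real k + 1"
  unfolding HILL_def
proof (rule cSup_least)
  \<comment> \<open>\<open>X\<close> itself witnesses that the supremum ranges over a nonempty set,
    as \<open>cSup_least\<close> requires.\<close>
  have "indist n (1000 * real n * (2 ^ k * eps\<^sup>2 + 1)) eps X X"
    using assms(1) by (simp add: indist_def)
  with X(1) show "{min_entropy Y |Y. set_pmf Y \<subseteq> bits n \<and>
      indist n (1000 * real n * (2 ^ k * eps\<^sup>2 + 1)) eps X Y} \<noteq> {}" by blast
qed (use min_entropy_le_of_indist[OF assms] in blast)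

theorem theorem1:
  shows "\<exists>c::real. c > 0 \<and>
    (\<forall>(n::nat) (k::nat) (eps::real).
       0 < eps \<and> eps \<le> 1/2 \<longrightarrow>
       (\<forall>f :: bool list \<Rightarrow> bool list. f ` bits k \<subseteq> bits n \<longrightarrow>
          HILL n (c * real n * (2 ^ k * eps\<^sup>2 + 1)) eps
               (map_pmf f (pmf_of_set (bits k))) \<le> real k + 1)
     \<and> (\<forall>X :: bool list pmf. set_pmf X \<subseteq> bits n \<and> card (set_pmf X) \<le> 2 ^ k \<longrightarrow>
          HILL n (c * real n * (2 ^ k * eps\<^sup>2 + 1)) eps X \<le> real k + 1))"
proof (intro exI[of _ 1000] conjI allI impI)
  fix n k :: nat and eps :: real and f :: "bool list \<Rightarrow> bool list"
  assume eps: "0 < eps \<and> eps \<le> 1/2" and f: "f ` bits k \<subseteq> bits n"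
  \<comment> \<open>Nonemptiness gives \<open>pmf_of_set\<close> its intended support. The image of
    the cube then has at most \<open>2 ^ k\<close> points, and the general bound applies.\<close>
  have "bits k \<noteq> {}" using card_bits[of k] by (metis card.empty power_not_zero zero_neq_numeral)
  then have supp: "set_pmf (map_pmf f (pmf_of_set (bits k))) = f ` bits k" by simp
  show "HILL n (1000 * real n * (2 ^ k * eps\<^sup>2 + 1)) eps
      (map_pmf f (pmf_of_set (bits k))) \<le> real k + 1"
    using eps f card_image_le[of "bits k" f]
    by (intro HILL_le) (simp_all only: supp card_bits finite_bits simp_thms)
qed (auto intro: HILL_le)

end
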